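(* For all $p'>p\ge1$ there exists a function $f\in HB^p_{(-\infty,\infty)}$ such that for every $H>0$, every function $g$ on $\Pi_{[-H,H]}$ with $d^{B^p}_{[-H,H]}(f,g)=0$ (that is, $g$ is equivalent to $f$ in $B^p_{[-H,H]}$) does not belong to $B^{p'}_{[-H,H]}$.
   Context: For real $\alpha\le\beta$ let $\Pi_{[\alpha,\beta]}=\{z=x+iy\in\mathbf C:\ x\in\mathbf R,\ \alpha\le y\le\beta\}$. A finite exponential sum on $\Pi_{[\alpha,\beta]}$ is a function $\sum_{n=1}^N c_n(y)e^{i\lambda_n x}$ with $\lambda_n\in\mathbf R$ and $c_n$ continuous complex-valued functions on $[\alpha,\beta]$. For $p\ge1$ and complex-valued functions $g,h$ on $\Pi_{[\alpha,\beta]}$ that are measurable and such that $|g(x+iy)|^p$, $|h(x+iy)|^p$ are locally integrable in $x$ for each fixed $y$, the Besicovitch distance of order $p$ is $$d^{B^p}_{[\alpha,\beta]}(g,h)=\limsup_{T\to\infty}\ \sup_{\alpha\le y\le\beta}\left(\frac1{2T}\int_{-T}^{T}|g(t+iy)-h(t+iy)|^p\,dt\right)^{1/p}.$$ $B^p_{[\alpha,\beta]}$ is the closure of the set of finite exponential sums in this (pseudo)metric: $f\in B^p_{[\alpha,\beta]}$ if for every $\varepsilon>0$ there is a finite exponential sum $Q$ with $d^{B^p}_{[\alpha,\beta]}(f,Q)<\varepsilon$. Two functions are equivalent in $B^p_{[\alpha,\beta]}$ if their distance $d^{B^p}_{[\alpha,\beta]}$ is $0$. $HB^p_{(-\infty,\infty)}$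 is the set of entire functions $f$ on $\mathbf C$ whose restriction to $\Pi_{[\alpha,\beta]}$ belongs to $B^p_{[\alpha,\beta]}$ for all real $\alpha<\beta$. *)

theory Defs
  imports "HOL-Analysis.Analysis"
begin

definition strip :: "real \<Rightarrow> real \<Rightarrow> complex set" where
  "strip \<alpha> \<beta> = {z. \<alpha> \<le> Im z \<and> Im z \<le> \<beta>}"

text \<open>
  Functions on a strip are represented by total functions on the complex plane; every notion
  below depends only on their values on the strip.
\<close>

definition finite_exp_sum :: "real \<Rightarrow> real \<Rightarrow> (complex \<Rightarrow> complex) \<Rightarrow> bool" where
  "finite_exp_sum \<alpha> \<beta> Q \<longleftrightarrow>
     (\<exists>(N::nat) (c :: nat \<Rightarrow> real \<Rightarrow> complex) (l :: nat \<Rightarrow> real).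
        (\<forall>n<N. continuous_on {\<alpha>..\<beta>} (c n)) \<and>
        (\<forall>z\<in>strip \<alpha> \<beta>. Q z = (\<Sum>n<N. c n (Im z) * exp (\<i> * of_real (l n * Re z)))))"

text \<open>
  The functions between which the Besicovitch distance of order \<open>p\<close> is defined. Joint Lebesgue
  measurability gives measurable horizontal sections only for almost every height, so
  measurability of each section, which the integrals require, is stated separately.
\<close>

definition besicovitch_admissible ::
    "real \<Rightarrow> real \<Rightarrow> real \<Rightarrow> (complex \<Rightarrow> complex) \<Rightarrow> bool" where
  "besicovitch_admissible p \<alpha> \<beta> g \<longleftrightarrow>
     g \<in> borel_measurable (lebesgue_on (strip \<alpha> \<beta>)) \<and>
     (\<forall>y\<in>{\<alpha>..\<beta>}.
        (\<lambda>x. g (Complex x y)) \<in> borel_measurable lebesgue \<and>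
        (\<forall>T>0. set_integrable lebesgue {-T..T} (\<lambda>x. norm (g (Complex x y)) powr p)))"

text \<open>
  The distance may be infinite, hence the extended reals. It is meaningful for \<open>\<alpha> \<le> \<beta>\<close> and
  admissible arguments, for which the integrand is integrable.
\<close>

definition besicovitch_dist ::
    "real \<Rightarrow> real \<Rightarrow> real \<Rightarrow> (complex \<Rightarrow> complex) \<Rightarrow> (complex \<Rightarrow> complex) \<Rightarrow> ereal" where
  "besicovitch_dist p \<alpha> \<beta> g h =
     Limsup at_top (\<lambda>T::real. SUP y\<in>{\<alpha>..\<beta>}.
       ereal ((1 / (2 * T) *
         (LINT t:{-T..T}|lebesgue. norm (g (Complex t y) - h (Complex t y)) powr p)) powr (1 / p)))"

definition besicovitch_space :: "real \<Rightarrow> real \<Rightarrow> real \<Rightarrow> (complex \<Rightarrow> complex) set" where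
  "besicovitch_space p \<alpha> \<beta> =
     {f. besicovitch_admissible p \<alpha> \<beta> f \<and>
         (\<forall>\<epsilon>::real. \<epsilon> > 0 \<longrightarrow>
            (\<exists>Q. finite_exp_sum \<alpha> \<beta> Q \<and> besicovitch_dist p \<alpha> \<beta> f Q < ereal \<epsilon>))}"

definition besicovitch_equiv ::
    "real \<Rightarrow> real \<Rightarrow> real \<Rightarrow> (complex \<Rightarrow> complex) \<Rightarrow> (complex \<Rightarrow> complex) \<Rightarrow> bool" where
  "besicovitch_equiv p \<alpha> \<beta> f g \<longleftrightarrow>
     besicovitch_admissible p \<alpha> \<beta> f \<and> besicovitch_admissible p \<alpha> \<beta> g \<and>
     besicovitch_dist p \<alpha> \<beta> f g = 0"

definition entire_besicovitch :: "real \<Rightarrow> (complex \<Rightarrow> complex) set" where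
  "entire_besicovitch p =
     {f. f holomorphic_on UNIV \<and> (\<forall>\<alpha> \<beta>. \<alpha> < \<beta> \<longrightarrow> f \<in> besicovitch_space p \<alpha> \<beta>)}"

end

theory Submission
  imports Defs "HOL-Complex_Analysis.Complex_Analysis" "HOL-Real_Asymp.Real_Asymp"
begin

text \<open>
  The function \<open>sin (\<pi> z / L) ^ (2 L\<^sup>2)\<close> with \<open>L = 2 ^ j\<close> is an exponential sum which, on every strip, has
  bumps of bounded height and of width about 1 at the odd multiples of \<open>L / 2\<close> and is tiny elsewhere.
  Multiplied by \<open>L powr r\<close>, its mean \<open>p\<close>-th power is about \<open>L powr (r * p - 1)\<close>. With
  \<open>1 / p' < r < 1 / p\<close>, the sum of these functions over a sparse sequence of \<open>L\<close> therefore converges in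
  \<open>B\<^sup>p\<close>; it converges locally uniformly on the plane because the bumps move away from 0.

  On the real axis all terms are nonnegative, so the sum is at least \<open>L powr r / 2\<close> on a set of density
  about \<open>1 / L\<close>. If \<open>g\<close> is equivalent to the sum in \<open>B\<^sup>p\<close> and \<open>Q\<close> is an exponential sum (hence bounded) with
  distance less than 1 from \<open>g\<close> in \<open>B\<^sup>p\<^sup>'\<close>, then \<open>g\<close>, hence also \<open>g - Q\<close>, has size about \<open>L powr r\<close> on most
  of that set, and \<open>L powr (r * p' - 1)\<close> would be bounded.
\<close>

section \<open>Elementary estimates for sine and cosine\<close>

lemma abs_sin_ge:
  fixes x :: real
  assumes "\<bar>x\<bar> \<le> 2"
  shows "\<bar>x\<bar> / 3 \<le> \<bar>sin x\<bar>"
proof -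
  \<comment> \<open>The Taylor error is at most |x|^3/6, which is at most 2|x|/3 on this range. The
    cutoff 2 leaves room for pi/2, up to which the bound is applied.\<close>
  have "\<bar>sin x - (\<Sum>m<3. sin_coeff m * x ^ m)\<bar> \<le> inverse (fact 3) * \<bar>x\<bar> ^ 3"
    by (rule Maclaurin_sin_bound)
  moreover have "(\<Sum>m<3. sin_coeff m * x ^ m) = x"
    by (simp add: sin_coeff_def numeral_3_eq_3)
  moreover have "inverse (fact 3) * \<bar>x\<bar> ^ 3 \<le> 2/3 * \<bar>x\<bar>"
  proof -
    have "\<bar>x\<bar> * \<bar>x\<bar> \<le> 2 * 2" using assms by (intro mult_mono) auto
    then have "\<bar>x\<bar> * (\<bar>x\<bar> * \<bar>x\<bar>) \<le> \<bar>x\<bar> * 4" by (intro mult_left_mono) auto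
    then show ?thesis by (simp add: fact_numeral power3_eq_cube mult.assoc)
  qed
  ultimately show ?thesis by linarith
qed

text \<open>Half-odd multiples of pi are zeros of the cosine. Measuring from such a zero recentres
  the bump estimates at a peak.\<close>

lemma cos_half_odd_shift_squared:
  fixes t :: real and j :: int
  shows "(cos (pi * (of_int j + 1/2) + t))\<^sup>2 = (sin t)\<^sup>2"
proof -
  define a where "a = of_int j * pi"
  have sin: "sin a = 0" unfolding a_def by (metis sin_zero_iff_int2)
  then have cos: "(cos a)\<^sup>2 = 1" by (simp add: cos_squared_eq)
  have "pi * (of_int j + 1/2) + t = a + (pi / 2 + t)"
    by (simp add: a_def algebra_simps)
  then have "cos (pi * (of_int j + 1/2) + t) = cos a * - sin t"
    by (simp only: cos_add sin cos_pi_half sin_pi_half) simp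
  then show ?thesis by (simp add: power_mult_distrib cos)
qed

text \<open>With z = x + iy, |sin z|^2 = 1 - cos(x)^2 + sinh(y)^2, and sinh v <= v exp v for v = |y|
  follows from 1 - 2v <= exp(-2v). The factor y^2 is kept because it must cancel a large power
  later.\<close>

lemma norm_sin_squared_le:
  "(norm (sin z))\<^sup>2 \<le> 1 - (cos (Re z))\<^sup>2 + (Im z)\<^sup>2 * exp (2 * \<bar>Im z\<bar>)"
proof -
  define v where "v = \<bar>Im z\<bar>"
  have v: "v \<ge> 0" by (simp add: v_def)
  have e: "exp (2 * Im z) + inverse (exp (2 * Im z)) = exp (2 * v) + exp (- (2 * v))"
    by (auto simp: v_def abs_if exp_minus)
  have sq: "(exp v - exp (- v))\<^sup>2 = exp (2 * v) + exp (- (2 * v)) - 2"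
    by (simp add: power2_diff flip: exp_double exp_add)
  have "1 + - (2 * v) \<le> exp (- (2 * v))" by (rule exp_ge_add_one_self)
  then have "exp v * (1 - exp (- (2 * v))) \<le> exp v * (2 * v)"
    by (intro mult_left_mono) auto
  moreover have "exp v * exp (- (2 * v)) = exp (- v)"
    by (simp flip: exp_add)
  ultimately have le: "exp v - exp (- v) \<le> exp v * (2 * v)"
    by (simp add: algebra_simps)
  have "(exp v - exp (- v))\<^sup>2 \<le> (exp v * (2 * v))\<^sup>2"
    using le v by (intro power_mono) auto
  also have "\<dots> = 4 * (v\<^sup>2 * exp (2 * v))"
    by (simp add: power_mult_distrib exp_double)
  finally have "exp (2 * v) + exp (- (2 * v)) - 2 \<le> 4 * (v\<^sup>2 * exp (2 * v))"
    unfolding sq .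
  moreover have "(norm (sin z))\<^sup>2 = (exp (2 * v) + exp (- (2 * v)) - 2 * cos (2 * Re z)) / 4"
    by (simp add: norm_sin_squared e)
  moreover have "cos (2 * Re z) = 2 * (cos (Re z))\<^sup>2 - 1"
    by (simp add: cos_double_cos)
  ultimately have "(norm (sin z))\<^sup>2 \<le> 1 - (cos (Re z))\<^sup>2 + v\<^sup>2 * exp (2 * v)"
    by (simp add: field_simps)
  then show ?thesis by (simp add: v_def)
qed

lemma four_power: "(4::real) ^ j = (2 ^ j)\<^sup>2"
  by (simp add: power2_eq_square flip: power_mult_distrib)

subsection \<open>The bumps\<close>

text \<open>With L = 2^j, the squared sine falls by order (u/L)^2 at distance u from a peak and
  grows by order (y/L)^2 off the axis. Raising it to the power L^2 makes both effects independent of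
  \<open>j\<close>. The even exponent gives nonnegativity on the real axis.\<close>

definition bump :: "nat \<Rightarrow> complex \<Rightarrow> complex" where
  "bump j z = sin (of_real (pi / 2 ^ j) * z) ^ (2 * 4 ^ j)"

definition bump_const :: "real \<Rightarrow> real" where
  "bump_const H = exp ((pi * H)\<^sup>2 * exp (2 * (pi * H)))"

lemma bump_const_ge_1: "1 \<le> bump_const H"
  by (simp add: bump_const_def)

text \<open>The inequality 1 + t <= exp t turns the bound on the squared sine into an exponential,
  whose power 4^j is explicit. The part coming from the imaginary direction then no longer depends
  on \<open>j\<close> and is the logarithm of \<open>bump_const H\<close>.\<close>

lemma norm_bump_le:
  assumes "\<bar>y\<bar> \<le> H"
  shows "norm (bump j (Complex x y)) \<le> bump_const H * exp (- (4 ^ j * (cos (pi * x / 2 ^ j))\<^sup>2))"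
proof -
  define w where "w = of_real (pi / 2 ^ j) * Complex x y"
  define b where "b = pi * H / 2 ^ j"
  have H: "H \<ge> 0" using assms by linarith
  have Re: "Re w = pi * x / 2 ^ j" and Im: "Im w = pi * y / 2 ^ j"
    by (simp_all add: w_def)
  have Imb: "\<bar>Im w\<bar> \<le> b"
    using assms by (simp add: Im b_def abs_mult divide_right_mono)
  have b_le: "b \<le> pi * H"
    using H divide_left_mono[of 1 "2 ^ j" "pi * H"] by (simp add: b_def)
  have "(norm (sin w))\<^sup>2 \<le> 1 - (cos (Re w))\<^sup>2 + (Im w)\<^sup>2 * exp (2 * \<bar>Im w\<bar>)"
    by (rule norm_sin_squared_le)
  also have "(Im w)\<^sup>2 * exp (2 * \<bar>Im w\<bar>) \<le> b\<^sup>2 * exp (2 * (pi * H))"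
    using Imb b_le H by (intro mult_mono) (auto simp: abs_le_square_iff[symmetric])
  also have "1 - (cos (Re w))\<^sup>2 + b\<^sup>2 * exp (2 * (pi * H))
      \<le> exp (- (cos (Re w))\<^sup>2 + b\<^sup>2 * exp (2 * (pi * H)))"
    using exp_ge_add_one_self[of "- (cos (Re w))\<^sup>2 + b\<^sup>2 * exp (2 * (pi * H))"] by linarith
  finally have "((norm (sin w))\<^sup>2) ^ (4 ^ j)
      \<le> exp (- (cos (Re w))\<^sup>2 + b\<^sup>2 * exp (2 * (pi * H))) ^ (4 ^ j)"
    by (intro power_mono) auto
  also have "\<dots> = exp (4 ^ j * (- (cos (Re w))\<^sup>2 + b\<^sup>2 * exp (2 * (pi * H))))"
    by (simp flip: exp_of_nat_mult)
  also have "4 ^ j * (- (cos (Re w))\<^sup>2 + b\<^sup>2 * exp (2 * (pi * H)))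
      = (pi * H)\<^sup>2 * exp (2 * (pi * H)) + - (4 ^ j * (cos (Re w))\<^sup>2)"
  proof -
    have "4 ^ j * b\<^sup>2 = (pi * H)\<^sup>2" by (simp add: b_def power_divide four_power)
    then show ?thesis by (simp add: algebra_simps)
  qed
  finally show ?thesis
    unfolding bump_def bump_const_def exp_add [symmetric] Re
    by (simp add: norm_power power_mult w_def)
qed

text \<open>In the middle quarter-periods the argument stays within pi/4 of 0, so the squared cosine
  is at least 1/2. This covers all points lying well before the first peak.\<close>

lemma norm_bump_near_0_le:
  assumes "\<bar>y\<bar> \<le> H" and "\<bar>x\<bar> \<le> 2 ^ j / 4"
  shows "norm (bump j (Complex x y)) \<le> bump_const H * exp (- (4 ^ j / 2))"
proof -
  have "\<bar>pi * x / 2 ^ j\<bar> \<le> pi / 4"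
    using assms(2) by (simp add: abs_mult field_simps)
  then have "cos (pi / 4) \<le> cos \<bar>pi * x / 2 ^ j\<bar>"
    by (intro cos_monotone_0_pi_le) auto
  then have "sqrt 2 / 2 \<le> cos (pi * x / 2 ^ j)"
    by (simp add: cos_45 del: abs_divide)
  then have "(sqrt 2 / 2)\<^sup>2 \<le> (cos (pi * x / 2 ^ j))\<^sup>2"
    by (intro power_mono) auto
  then have "1 / 2 \<le> (cos (pi * x / 2 ^ j))\<^sup>2"
    by (simp add: power_divide)
  then have "- (4 ^ j * (cos (pi * x / 2 ^ j))\<^sup>2) \<le> - (4 ^ j * (1 / 2))"
    by simp
  then have "bump_const H * exp (- (4 ^ j * (cos (pi * x / 2 ^ j))\<^sup>2)) \<le> bump_const H * exp (- (4 ^ j / 2))"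
    using bump_const_ge_1[of H] by (intro mult_left_mono) auto
  then show ?thesis using norm_bump_le[OF assms(1), of j x] by linarith
qed

text \<open>For u the distance to a peak at most half a period away, |sin(pi u/L)| >= |u|/L, hence
  the decay is at least exp(-u^2) <= 1/(1 + u^2). The rational majorant is preferred because its
  primitive is arctan.\<close>

lemma norm_bump_le_rational:
  fixes i :: int
  assumes "\<bar>y\<bar> \<le> H" and "\<bar>x - (of_int i + 1/2) * 2 ^ j\<bar> \<le> 2 ^ j / 2"
  shows "norm (bump j (Complex x y)) \<le> bump_const H / (1 + (x - (of_int i + 1/2) * 2 ^ j)\<^sup>2)"
proof -
  define u where "u = x - (of_int i + 1/2) * 2 ^ j"
  have "pi * x / 2 ^ j = pi * (of_int i + 1/2) + pi * u / 2 ^ j"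
    by (simp add: u_def field_simps)
  then have cos: "(cos (pi * x / 2 ^ j))\<^sup>2 = (sin (pi * u / 2 ^ j))\<^sup>2"
    by (simp add: cos_half_odd_shift_squared)
  have u: "\<bar>u\<bar> \<le> 2 ^ j / 2" using assms(2) by (simp add: u_def)
  have "\<bar>pi * u / 2 ^ j\<bar> \<le> pi / 2"
    using u by (simp add: abs_mult field_simps)
  then have "\<bar>pi * u / 2 ^ j\<bar> \<le> 2" using pi_less_4 by linarith
  then have "\<bar>pi * u / 2 ^ j\<bar> / 3 \<le> \<bar>sin (pi * u / 2 ^ j)\<bar>"
    by (rule abs_sin_ge)
  moreover have "\<bar>u\<bar> / 2 ^ j \<le> \<bar>pi * u / 2 ^ j\<bar> / 3"
    using mult_right_mono[of 3 pi "\<bar>u\<bar>"] pi_gt3 by (simp add: abs_mult field_simps)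
  ultimately have "\<bar>u\<bar> / 2 ^ j \<le> \<bar>sin (pi * u / 2 ^ j)\<bar>" by linarith
  then have "(\<bar>u\<bar> / 2 ^ j)\<^sup>2 \<le> \<bar>sin (pi * u / 2 ^ j)\<bar>\<^sup>2"
    by (intro power_mono) auto
  then have "u\<^sup>2 \<le> 4 ^ j * (sin (pi * u / 2 ^ j))\<^sup>2"
    by (simp add: power_divide four_power field_simps)
  then have "1 + u\<^sup>2 \<le> exp (4 ^ j * (sin (pi * u / 2 ^ j))\<^sup>2)"
    using exp_ge_add_one_self[of "4 ^ j * (sin (pi * u / 2 ^ j))\<^sup>2"] by linarith
  then have "inverse (exp (4 ^ j * (sin (pi * u / 2 ^ j))\<^sup>2)) \<le> inverse (1 + u\<^sup>2)"
    by (intro le_imp_inverse_le) (auto simp: add_pos_nonneg)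
  then have "exp (- (4 ^ j * (cos (pi * x / 2 ^ j))\<^sup>2)) \<le> 1 / (1 + u\<^sup>2)"
    unfolding cos by (simp add: exp_minus inverse_eq_divide)
  then have "bump_const H * exp (- (4 ^ j * (cos (pi * x / 2 ^ j))\<^sup>2)) \<le> bump_const H * (1 / (1 + u\<^sup>2))"
    using bump_const_ge_1[of H] by (intro mult_left_mono) auto
  then show ?thesis using norm_bump_le[OF assms(1), of j x] unfolding u_def by simp
qed

lemma bump_of_real:
  "bump j (of_real x) = of_real ((sin (pi * x / 2 ^ j)) ^ (2 * 4 ^ j))"
  by (simp add: bump_def flip: sin_of_real)

lemma bump_near_peak_ge:
  fixes i :: int
  assumes "\<bar>x - (of_int i + 1/2) * 2 ^ j\<bar> \<le> 1/6"
  shows "1/2 \<le> Re (bump j (of_real x))"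
proof -
  define u where "u = x - (of_int i + 1/2) * 2 ^ j"
  have "pi * x / 2 ^ j = pi * (of_int i + 1/2) + pi * u / 2 ^ j"
    by (simp add: u_def field_simps)
  then have cos: "(cos (pi * x / 2 ^ j))\<^sup>2 = (sin (pi * u / 2 ^ j))\<^sup>2"
    by (simp add: cos_half_odd_shift_squared)
  have u: "\<bar>u\<bar> \<le> 1/6" using assms by (simp add: u_def)
  have "\<bar>sin (pi * u / 2 ^ j)\<bar> \<le> \<bar>pi * u / 2 ^ j\<bar>" by (rule abs_sin_x_le_abs_x)
  also have "\<dots> \<le> (4 * (1/6)) / 2 ^ j"
    using divide_right_mono[OF mult_mono[of pi 4 "\<bar>u\<bar>" "1/6"], of "2 ^ j"] pi_less_4 u
    by (simp add: abs_mult)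
  finally have "\<bar>sin (pi * u / 2 ^ j)\<bar>\<^sup>2 \<le> ((4 * (1/6)) / 2 ^ j)\<^sup>2"
    by (intro power_mono) auto
  then have s: "4 ^ j * (cos (pi * x / 2 ^ j))\<^sup>2 \<le> 1/2"
    unfolding cos by (simp add: power_divide four_power field_simps)
  \<comment> \<open>Bernoulli's inequality for (1 - cos^2)^(4^j). Using pi < 4 and |u| <= 1/6, the
    loss 4^j cos^2 is at most (2/3)^2 = 4/9.\<close>
  have "1 / 2 \<le> 1 + real (4 ^ j) * (- (cos (pi * x / 2 ^ j))\<^sup>2)"
    using s by simp
  also have "\<dots> \<le> (1 + - (cos (pi * x / 2 ^ j))\<^sup>2) ^ (4 ^ j)"
    by (rule Bernoulli_inequality) (simp add: abs_square_le_1)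
  also have "1 + - (cos (pi * x / 2 ^ j))\<^sup>2 = (sin (pi * x / 2 ^ j))\<^sup>2"
    by (simp add: sin_squared_eq)
  finally show ?thesis
    by (simp add: bump_of_real power_mult)
qed

lemma Re_bump_of_real_nonneg: "0 \<le> Re (bump j (of_real x))"
  by (simp add: bump_of_real power_mult)

section \<open>Mean p-th power of a single bump\<close>

lemma nn_integral_inverse_square_le:
  fixes c T :: real
  assumes "0 < T"
  shows "(\<integral>\<^sup>+x. ennreal (1 / (1 + (x - c)\<^sup>2)) * indicator {-T..T} x \<partial>lborel) \<le> ennreal 4"
proof -
  have "(\<integral>\<^sup>+x. ennreal (1 / (1 + (x - c)\<^sup>2)) * indicator {-T..T} x \<partial>lborel)
      = arctan (T - c) - arctan (- T - c)"
  proof (rule nn_integral_FTC_Icc)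
    fix x :: real
    show "((\<lambda>x. arctan (x - c)) has_real_derivative 1 / (1 + (x - c)\<^sup>2)) (at x)"
      by (auto intro!: derivative_eq_intros simp: add_nonneg_eq_0_iff divide_inverse)
  qed (use assms in auto)
  also have "arctan (T - c) - arctan (- T - c) \<le> 4"
    using arctan_bounded[of "T - c"] arctan_bounded[of "- T - c"] pi_less_4 by linarith
  finally show ?thesis by (simp add: ennreal_leI)
qed

text \<open>As u <= 1 and p >= 1, the power u^p is at most u. One integral bound for the rational
  majorant thus serves every p.\<close>

lemma powr_le_mult_powr:
  fixes K u p v :: real
  assumes "0 \<le> v" "v \<le> K * u" "0 \<le> K" "0 \<le> u" "u \<le> 1" "1 \<le> p"
  shows "v powr p \<le> K powr p * u"
proof -
  have "v powr p \<le> (K * u) powr p" using assms by (intro powr_mono2) auto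
  also have "\<dots> = K powr p * u powr p" using assms by (simp add: powr_mult)
  also have "u powr p \<le> u powr 1" using assms by (intro powr_mono') auto
  finally show ?thesis using assms by (simp add: mult_left_mono)
qed

text \<open>The bound holds for every T > 0, not only for large T, so that at a fixed T it can be
  summed over all scales. Windows with T <= L/4 do not reach a peak and the bump is tiny there;
  longer windows meet O(T/L) peaks, each of bounded mass.\<close>

lemma nn_integral_bump_powr_le:
  assumes "0 < T" "1 \<le> p" "\<bar>y\<bar> \<le> H"
  shows "(\<integral>\<^sup>+x. ennreal (norm (bump j (Complex x y)) powr p) * indicator {-T..T} x \<partial>lborel)
    \<le> ennreal (2 * T * (28 * bump_const H powr p / 2 ^ j))"
proof -
  define L :: real where "L = 2 ^ j"
  define C where "C = bump_const H powr p"
  have L: "1 \<le> L" by (simp add: L_def)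
  have K: "0 \<le> bump_const H" using bump_const_ge_1[of H] by linarith
  have C: "0 \<le> C" by (simp add: C_def)
  show ?thesis
  proof (cases "T \<le> L / 4")
    case True
    have "L \<le> 1 + L\<^sup>2 / 2"
      using zero_le_power2[of "L - 1"] by (simp add: power2_diff)
    also have "\<dots> \<le> exp (4 ^ j / 2)"
      using exp_ge_add_one_self[of "4 ^ j / 2"] by (simp add: L_def four_power)
    finally have "exp (- (4 ^ j / 2)) \<le> 1 / L"
      using L by (simp add: exp_minus inverse_eq_divide field_simps)
    moreover have "norm (bump j (Complex x y)) powr p \<le> C * exp (- (4 ^ j / 2))"
      if "x \<in> {-T..T}" for x
      unfolding C_def using that True K assms
      by (intro powr_le_mult_powr norm_bump_near_0_le) (auto simp: L_def)
    ultimately have bound: "norm (bump j (Complex x y)) powr p \<le> C / L" if "x \<in> {-T..T}" for x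
      using that C mult_left_mono[of "exp (- (4 ^ j / 2))" "1 / L" C] by fastforce
    have "(\<integral>\<^sup>+x. ennreal (norm (bump j (Complex x y)) powr p) * indicator {-T..T} x \<partial>lborel)
        \<le> (\<integral>\<^sup>+x. ennreal (C / L) * indicator {-T..T} x \<partial>lborel)"
      using bound by (intro nn_integral_mono) (auto simp: indicator_def ennreal_leI)
    also have "\<dots> = ennreal (C / L) * ennreal (2 * T)"
      using assms(1) by (simp add: nn_integral_cmult_indicator)
    also have "\<dots> = ennreal (C / L * (2 * T))"
      by (rule ennreal_mult[symmetric]) (use assms(1) C L in auto)
    also have "\<dots> \<le> ennreal (2 * T * (28 * C / L))"
      using assms(1) C L by (intro ennreal_leI) (simp add: field_simps)
    finally show ?thesis by (simp add: C_def L_def)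
  next
    case False
    define M where "M = \<lceil>T / L\<rceil>"
    define c where "c i = (of_int i + 1/2) * L" for i :: int
    have q: "0 < T / L" using assms(1) L by (intro divide_pos_pos) auto
    have M: "0 \<le> M" "T / L \<le> of_int M" "of_int M \<le> T / L + 1"
      unfolding M_def zero_le_ceiling using q by linarith+
    have bound: "norm (bump j (Complex x y)) powr p \<le> (\<Sum>i\<in>{-M..M}. C * (1 / (1 + (x - c i)\<^sup>2)))"
      if x: "x \<in> {-T..T}" for x
    proof -
      \<comment> \<open>The point lies in the period cell from i L to (i+1) L, whose midpoint
        \<open>c i\<close> is a peak at distance at most L/2.\<close>
      define i where "i = \<lfloor>x / L\<rfloor>"
      have xi: "of_int i \<le> x / L" "x / L < of_int i + 1" by (auto simp: i_def)
      have xT: "x / L \<le> T / L" "- (T / L) \<le> x / L"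
        using x L by (auto simp: divide_right_mono field_simps)
      have "i \<in> {-M..M}" using xi xT M by (auto simp: i_def le_floor_iff floor_le_iff)
      moreover have near: "\<bar>x - c i\<bar> \<le> L / 2"
        using xi L by (auto simp: c_def field_simps abs_le_iff)
      ultimately have "C * (1 / (1 + (x - c i)\<^sup>2)) \<le> (\<Sum>i\<in>{-M..M}. C * (1 / (1 + (x - c i)\<^sup>2)))"
        using C by (intro member_le_sum) auto
      moreover have "norm (bump j (Complex x y)) powr p \<le> C * (1 / (1 + (x - c i)\<^sup>2))"
        unfolding C_def
      proof (rule powr_le_mult_powr)
        show "norm (bump j (Complex x y)) \<le> bump_const H * (1 / (1 + (x - c i)\<^sup>2))"
          using norm_bump_le_rational[OF assms(3), of x i j] near by (simp add: L_def c_def)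
      qed (use K assms(2) in \<open>auto simp: field_simps add_pos_nonneg\<close>)
      ultimately show ?thesis by linarith
    qed
    have "(\<integral>\<^sup>+x. ennreal (norm (bump j (Complex x y)) powr p) * indicator {-T..T} x \<partial>lborel)
        \<le> (\<integral>\<^sup>+x. (\<Sum>i\<in>{-M..M}. ennreal C * (ennreal (1 / (1 + (x - c i)\<^sup>2)) * indicator {-T..T} x)) \<partial>lborel)"
    proof (rule nn_integral_mono)
      fix x
      show "ennreal (norm (bump j (Complex x y)) powr p) * indicator {-T..T} x
          \<le> (\<Sum>i\<in>{-M..M}. ennreal C * (ennreal (1 / (1 + (x - c i)\<^sup>2)) * indicator {-T..T} x))"
      proof (cases "x \<in> {-T..T}")
        case True
        have "(\<Sum>i\<in>{-M..M}. ennreal C * ennreal (1 / (1 + (x - c i)\<^sup>2)))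
            = (\<Sum>i\<in>{-M..M}. ennreal (C * (1 / (1 + (x - c i)\<^sup>2))))"
          using C by (intro sum.cong refl ennreal_mult[symmetric]) auto
        also have "\<dots> = ennreal (\<Sum>i\<in>{-M..M}. C * (1 / (1 + (x - c i)\<^sup>2)))"
          using C by (intro sum_ennreal) auto
        finally have "(\<Sum>i\<in>{-M..M}. ennreal C * ennreal (1 / (1 + (x - c i)\<^sup>2)))
            = ennreal (\<Sum>i\<in>{-M..M}. C * (1 / (1 + (x - c i)\<^sup>2)))" .
        then show ?thesis using True bound[OF True] by (simp add: ennreal_leI)
      qed auto
    qed
    also have "\<dots> = (\<Sum>i\<in>{-M..M}. ennreal C *
        (\<integral>\<^sup>+x. ennreal (1 / (1 + (x - c i)\<^sup>2)) * indicator {-T..T} x \<partial>lborel))"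
      by (subst nn_integral_sum) (auto simp: nn_integral_cmult)
    also have "\<dots> \<le> (\<Sum>i\<in>{-M..M}. ennreal C * ennreal 4)"
      by (intro sum_mono mult_left_mono nn_integral_inverse_square_le assms(1)) auto
    also have "\<dots> = (\<Sum>i\<in>{-M..M}. ennreal (C * 4))"
      using C by (intro sum.cong refl ennreal_mult[symmetric]) auto
    also have "\<dots> = ennreal (\<Sum>i\<in>{-M..M}. C * 4)"
      using C by (intro sum_ennreal) auto
    also have "(\<Sum>i\<in>{-M..M}. C * 4) = of_int (2 * M + 1) * (C * 4)"
      using M(1) by simp
    also have "\<dots> \<le> ennreal (2 * T * (28 * C / L))"
    proof (rule ennreal_leI)
      \<comment> \<open>Here 2M + 1 <= 2T/L + 3, and L < 4T gives 3 <= 12 T/L. With mass 4C per peak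
        this yields 56 = 2 * 28.\<close>
      have "of_int (2 * M + 1) \<le> 14 * (T / L)"
        using M(3) False L by (simp add: field_simps)
      then have "of_int (2 * M + 1) * (C * 4) \<le> 14 * (T / L) * (C * 4)"
        using C by (intro mult_right_mono) auto
      then show "of_int (2 * M + 1) * (C * 4) \<le> 2 * T * (28 * C / L)"
        by (simp add: field_simps)
    qed
    finally show ?thesis by (simp add: C_def L_def)
  qed
qed

text \<open>A substitute for Minkowski's inequality: if the right side is a finite S, each term has
  norm at most S^(1/p) / 2^(k+1), and these weights sum to 1. The geometric weights are absorbed
  later by the sparsity of the scales.\<close>

lemma norm_suminf_powr_le:
  fixes a :: "nat \<Rightarrow> 'a::banach" and p :: real
  assumes "summable (\<lambda>k. norm (a k))" and "0 < p"
  shows "ennreal (norm (\<Sum>k. a k) powr p) \<le> (\<Sum>k. ennreal ((2 ^ Suc k * norm (a k)) powr p))"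
proof -
  define b where "b = (\<lambda>k. ennreal ((2 ^ Suc k * norm (a k)) powr p))"
  have "ennreal (norm (\<Sum>k. a k) powr p) \<le> suminf b"
  proof (cases "suminf b" rule: ennreal_cases)
    case S: (real S)
    define s where "s = S powr (1 / p)"
    have le: "norm (a k) \<le> s * (1/2) ^ Suc k" for k
    proof -
      have "sum b {k} \<le> suminf b"
        by (rule sum_le_suminf) auto
      then have "b k \<le> ennreal S" using S(2) by simp
      then have "(2 ^ Suc k * norm (a k)) powr p \<le> S"
        using S(1) unfolding b_def by (subst (asm) ennreal_le_iff)
      then have "((2 ^ Suc k * norm (a k)) powr p) powr (1 / p) \<le> s"
        unfolding s_def using assms(2) by (intro powr_mono2) auto
      then have "2 ^ Suc k * norm (a k) \<le> s"
        using assms(2) by (simp add: powr_powr)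
      then show ?thesis by (simp add: field_simps)
    qed
    have "norm (\<Sum>k. a k) \<le> (\<Sum>k. norm (a k))" by (rule summable_norm[OF assms(1)])
    also have "\<dots> \<le> (\<Sum>k. s * (1/2) ^ Suc k)"
      using le assms(1) sums_mult[OF power_half_series, of s]
      by (intro suminf_le) (auto simp: sums_iff)
    also have "\<dots> = s" using sums_mult[OF power_half_series, of s] by (simp add: sums_iff)
    finally have "norm (\<Sum>k. a k) powr p \<le> s powr p" using assms(2) by (intro powr_mono2) auto
    also have "\<dots> = S" using assms(2) S(1) by (simp add: s_def powr_powr)
    finally show ?thesis unfolding S(2) by (rule ennreal_leI)
  qed simp
  then show ?thesis unfolding b_def .
qed

subsection \<open>The series\<close>

text \<open>The parameter \<open>m\<close> spreads out the scales L = 2^(m(k+1)); a large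
  \<open>m\<close> lets the decay of the means in \<open>k\<close> beat the weights 2^((k+1)p) of
  the series estimate.\<close>

definition spike :: "real \<Rightarrow> nat \<Rightarrow> nat \<Rightarrow> complex \<Rightarrow> complex" where
  "spike r m k z = of_real ((2 ^ (m * Suc k)) powr r) * bump (m * Suc k) z"

definition spike_series :: "real \<Rightarrow> nat \<Rightarrow> complex \<Rightarrow> complex" where
  "spike_series r m z = (\<Sum>k. spike r m k z)"

lemma holomorphic_spike: "spike r m k holomorphic_on A"
  unfolding spike_def bump_def by (intro holomorphic_intros)

text \<open>The weight contributes 2^((k+1)p), the amplitude L^(rp) and the bump 1/L. The hypothesis
  on \<open>m\<close> says exactly that the product of these is at most 2^(-(k+1)).\<close>

lemma nn_integral_spike_powr_le:
  assumes "0 < T" "1 \<le> p" "\<bar>y\<bar> \<le> H" and m: "p + 1 \<le> real m * (1 - r * p)"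
  shows "(\<integral>\<^sup>+x. ennreal ((2 ^ Suc k * norm (spike r m k (Complex x y))) powr p) * indicator {-T..T} x \<partial>lborel)
    \<le> ennreal (2 * T * (28 * bump_const H powr p) * (1/2) ^ Suc k)"
proof -
  define j where "j = m * Suc k"
  define A where "A = (2 ^ Suc k * (2 ^ j) powr r) powr p"
  have A: "0 \<le> A" by (simp add: A_def)
  have pk: "2 ^ Suc k = 2 powr real (Suc k)" and pj: "2 ^ j = 2 powr (real m * real (Suc k))"
    unfolding j_def of_nat_mult[symmetric] by (subst powr_realpow; simp)+
  have "A = 2 powr (real (Suc k) * (p + real m * (r * p)))"
    unfolding A_def pk pj powr_powr powr_add[symmetric] by (simp add: algebra_simps)
  also have "\<dots> \<le> 2 powr (real (Suc k) * (real m - 1))"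
    using m by (intro powr_mono mult_left_mono) (auto simp: algebra_simps)
  also have "\<dots> = 2 ^ j / 2 ^ Suc k"
    unfolding pk pj powr_diff[symmetric] by (simp add: algebra_simps)
  finally have le: "A / 2 ^ j \<le> (1/2) ^ Suc k" by (simp add: field_simps power_divide)
  have [measurable]: "(\<lambda>x. bump j (Complex x y)) \<in> borel_measurable borel"
    unfolding bump_def Complex_eq by (intro borel_measurable_continuous_onI continuous_intros)
  have "(\<integral>\<^sup>+x. ennreal ((2 ^ Suc k * norm (spike r m k (Complex x y))) powr p) * indicator {-T..T} x \<partial>lborel)
      = (\<integral>\<^sup>+x. ennreal A * (ennreal (norm (bump j (Complex x y)) powr p) * indicator {-T..T} x) \<partial>lborel)"
    by (intro nn_integral_cong)
      (auto simp: spike_def A_def j_def norm_mult powr_mult ennreal_mult mult_ac indicator_def)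
  also have "\<dots> = ennreal A * (\<integral>\<^sup>+x. (ennreal (norm (bump j (Complex x y)) powr p) * indicator {-T..T} x) \<partial>lborel)"
    by (rule nn_integral_cmult) measurable
  also have "\<dots> \<le> ennreal A * ennreal (2 * T * (28 * bump_const H powr p / 2 ^ j))"
    by (intro mult_left_mono nn_integral_bump_powr_le assms) auto
  also have "\<dots> = ennreal (2 * T * (28 * bump_const H powr p) * (A / 2 ^ j))"
    using A assms(1) by (simp add: ennreal_mult[symmetric] mult_ac)
  also have "\<dots> \<le> ennreal (2 * T * (28 * bump_const H powr p) * (1/2) ^ Suc k)"
    using le assms(1) by (intro ennreal_leI mult_left_mono) auto
  finally show ?thesis .
qed

text \<open>Once 4R <= 2^k <= L the disc lies before the first peak. The super-exponential smallness
  of the bump there outweighs the amplitude, which is at most L, and a geometric rate suffices for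
  the Weierstrass test.\<close>

lemma norm_spike_le:
  assumes "norm z \<le> R" "4 * R \<le> 2 ^ k" "1 \<le> m" "r \<le> 1"
  shows "norm (spike r m k z) \<le> 8 * bump_const R * (1/2) ^ k"
proof -
  define j where "j = m * Suc k"
  define L :: real where "L = 2 ^ j"
  have "k \<le> j" using mult_le_mono1[OF assms(3), of "Suc k"] by (simp add: j_def)
  then have kL: "2 ^ k \<le> L" by (simp add: L_def)
  have L: "1 \<le> L" by (simp add: L_def)
  have K: "0 \<le> bump_const R" using bump_const_ge_1[of R] by linarith
  have z: "\<bar>Im z\<bar> \<le> R" "\<bar>Re z\<bar> \<le> R"
    using abs_Im_le_cmod[of z] abs_Re_le_cmod[of z] assms(1) by linarith+
  have "norm (bump j (Complex (Re z) (Im z))) \<le> bump_const R * exp (- (4 ^ j / 2))"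
    using z(1)
  proof (rule norm_bump_near_0_le)
    show "\<bar>Re z\<bar> \<le> 2 ^ j / 4" unfolding L_def[symmetric] using z(2) kL assms(2) by linarith
  qed
  \<comment> \<open>This is exp t >= t^2/2 at t = L^2/2.\<close>
  also have "exp (- (4 ^ j / 2)) \<le> 8 / L ^ 4"
  proof -
    have "(4 ^ j / 2)\<^sup>2 / 2 \<le> exp (4 ^ j / 2 :: real)"
      using exp_lower_Taylor_quadratic[of "4 ^ j / 2 :: real"] zero_le_power[of "4::real" j] by linarith
    moreover have "(4 ^ j / 2)\<^sup>2 / 2 = L ^ 4 / 8"
      by (simp add: L_def four_power power_divide flip: power_mult)
    ultimately show ?thesis using L by (simp add: exp_minus field_simps)
  qed
  finally have b: "norm (bump j z) \<le> bump_const R * (8 / L ^ 4)" using K by (simp add: mult_left_mono)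
  have "L powr r \<le> L powr 1" using L assms(4) by (intro powr_mono) auto
  then have "L powr r \<le> L" using L by simp
  then have "L powr r * norm (bump j z) \<le> L * (bump_const R * (8 / L ^ 4))"
    using b L by (intro mult_mono) auto
  also have "\<dots> = 8 * bump_const R * (1 / L ^ 3)"
    using L by (simp add: field_simps power4_eq_xxxx power3_eq_cube)
  also have "\<dots> \<le> 8 * bump_const R * (1 / 2 ^ k)"
  proof -
    have "L ^ 1 \<le> L ^ 3" using L by (intro power_increasing) auto
    then show ?thesis using kL K L by (intro mult_left_mono divide_left_mono mult_pos_pos) auto
  qed
  finally show ?thesis by (simp add: spike_def L_def j_def norm_mult power_one_over)
qed

lemma eventually_norm_spike_le:
  assumes "1 \<le> m" "r \<le> 1"
  shows "\<forall>\<^sub>F k in sequentially. \<forall>z\<in>cball 0 R. norm (spike r m k z) \<le> 8 * bump_const R * (1/2) ^ k"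
proof -
  obtain K :: nat where K: "4 * R < 2 ^ K" using real_arch_pow[of 2 "4 * R"] by auto
  have "4 * R \<le> 2 ^ k" if "K \<le> k" for k
    using K power_increasing[OF that, of "2::real"] by linarith
  then show ?thesis
    using norm_spike_le assms by (auto simp: eventually_sequentially intro!: exI[of _ K])
qed

lemma summable_norm_spike:
  assumes "1 \<le> m" "r \<le> 1"
  shows "summable (\<lambda>k. norm (spike r m k z))"
proof (rule summable_comparison_test_ev)
  show "\<forall>\<^sub>F k in sequentially. norm (norm (spike r m k z)) \<le> 8 * bump_const (norm z) * (1/2) ^ k"
    using eventually_norm_spike_le[OF assms, of "norm z"] by eventually_elim auto
qed (intro summable_mult summable_geometric, simp)

lemma holomorphic_spike_series:
  assumes "1 \<le> m" "r \<le> 1"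
  shows "spike_series r m holomorphic_on UNIV"
proof (rule holomorphic_uniform_sequence)
  fix z :: complex
  have "uniform_limit (cball 0 (norm z + 1)) (\<lambda>n z. \<Sum>k<n. spike r m k z) (\<lambda>z. \<Sum>k. spike r m k z) sequentially"
    by (rule Weierstrass_m_test_ev[OF eventually_norm_spike_le[OF assms]])
      (intro summable_mult summable_geometric, simp)
  then have "uniform_limit (cball z 1) (\<lambda>n z. \<Sum>k<n. spike r m k z) (spike_series r m) sequentially"
    unfolding spike_series_def
  proof (rule uniform_limit_on_subset)
    show "cball z 1 \<subseteq> cball 0 (norm z + 1)"
      by (auto simp: dist_norm) (metis add.commute norm_minus_commute norm_triangle_sub order_trans add_left_mono)
  qed
  then show "\<exists>d>0. cball z d \<subseteq> UNIV \<and>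
      uniform_limit (cball z d) (\<lambda>n z. \<Sum>k<n. spike r m k z) (spike_series r m) sequentially"
    by (intro exI[of _ 1]) auto
qed (auto intro!: holomorphic_intros holomorphic_spike)

lemma nn_integral_spike_series_tail_le:
  assumes "0 < T" "1 \<le> p" "\<bar>y\<bar> \<le> H" "p + 1 \<le> real m * (1 - r * p)" "1 \<le> m" "r \<le> 1"
  shows "(\<integral>\<^sup>+x. ennreal (norm (spike_series r m (Complex x y) - (\<Sum>k<K. spike r m k (Complex x y))) powr p)
      * indicator {-T..T} x \<partial>lborel)
    \<le> ennreal (2 * T * (28 * bump_const H powr p * (1/2) ^ K))"
proof -
  define a where "a k x = spike r m (k + K) (Complex x y)" for k x
  define D where "D = 2 * T * (28 * bump_const H powr p)"
  have D: "0 \<le> D" using assms(1) by (simp add: D_def)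
  have tail: "spike_series r m (Complex x y) - (\<Sum>k<K. spike r m k (Complex x y)) = (\<Sum>k. a k x)" for x
    unfolding spike_series_def a_def
    using suminf_minus_initial_segment[OF summable_norm_cancel[OF summable_norm_spike[OF assms(5,6)]]] by simp
  have summ: "summable (\<lambda>k. norm (a k x))" for x
    unfolding a_def using summable_norm_spike[OF assms(5,6)] by (rule summable_ignore_initial_segment)
  have pt: "ennreal (norm (\<Sum>k. a k x) powr p)
      \<le> (\<Sum>k. ennreal ((2 ^ Suc (k + K) * norm (a k x)) powr p))" for x
  proof -
    have "ennreal (norm (\<Sum>k. a k x) powr p) \<le> (\<Sum>k. ennreal ((2 ^ Suc k * norm (a k x)) powr p))"
      using assms(2) by (intro norm_suminf_powr_le summ) auto
    \<comment> \<open>The weights are enlarged to those of the unshifted indices, so that the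
      estimate for single spikes applies and a geometric tail of size 2^(-K) remains.\<close>
    also have "\<dots> \<le> (\<Sum>k. ennreal ((2 ^ Suc (k + K) * norm (a k x)) powr p))"
      using assms(2) by (intro suminf_le ennreal_leI powr_mono2 mult_right_mono power_increasing) auto
    finally show ?thesis .
  qed
  have [measurable]: "(\<lambda>x. a k x) \<in> borel_measurable borel" for k
    unfolding a_def spike_def bump_def Complex_eq by (intro borel_measurable_continuous_onI continuous_intros)
  define b where "b k x = ennreal ((2 ^ Suc (k + K) * norm (a k x)) powr p)" for k x
  have [measurable]: "(\<lambda>x. b k x) \<in> borel_measurable borel" for k
    unfolding b_def by measurable
  have "(\<integral>\<^sup>+x. ennreal (norm (\<Sum>k. a k x) powr p) * indicator {-T..T} x \<partial>lborel)
      \<le> (\<integral>\<^sup>+x. (\<Sum>k. b k x) * indicator {-T..T} x \<partial>lborel)"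
    by (rule nn_integral_mono, rule mult_right_mono) (simp_all only: pt[folded b_def] zero_le)
  also have "\<dots> = (\<integral>\<^sup>+x. (\<Sum>k. b k x * indicator {-T..T} x) \<partial>lborel)"
    by (simp add: ennreal_suminf_multc)
  also have "\<dots> = (\<Sum>k. \<integral>\<^sup>+x. b k x * indicator {-T..T} x \<partial>lborel)"
    by (rule nn_integral_suminf) measurable
  also have "\<dots> \<le> (\<Sum>k. ennreal (D * (1/2) ^ Suc (k + K)))"
    unfolding a_def b_def D_def by (intro suminf_le nn_integral_spike_powr_le assms) auto
  also have "\<dots> = ennreal (D * (1/2) ^ K)"
  proof (rule suminf_ennreal_eq)
    show "(\<lambda>k. D * (1/2) ^ Suc (k + K)) sums (D * (1/2) ^ K)"
      using sums_mult[OF power_half_series, of "D * (1/2) ^ K"] by (simp add: power_add mult_ac)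
  qed (use D in simp)
  finally show ?thesis unfolding tail D_def by (simp add: mult_ac)
qed

subsection \<open>Exponential sums and the Besicovitch distance\<close>

lemma finite_exp_sum_const: "finite_exp_sum \<alpha> \<beta> (\<lambda>z. k)"
  unfolding finite_exp_sum_def
  by (intro exI[of _ 1] exI[of _ "\<lambda>_ _. k"] exI[of _ "\<lambda>_. 0"]) simp

lemma sum_lessThan_add:
  fixes f :: "nat \<Rightarrow> 'a::comm_monoid_add"
  shows "sum f {..<a + b} = sum f {..<a} + (\<Sum>i<b. f (a + i))"
  by (induction b) (simp_all add: add_ac)

lemma finite_exp_sum_add:
  assumes "finite_exp_sum \<alpha> \<beta> P" "finite_exp_sum \<alpha> \<beta> Q"
  shows "finite_exp_sum \<alpha> \<beta> (\<lambda>z. P z + Q z)"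
proof -
  obtain M :: nat and c l where P: "\<forall>n<M. continuous_on {\<alpha>..\<beta>} (c n)"
      "\<forall>z\<in>strip \<alpha> \<beta>. P z = (\<Sum>n<M. c n (Im z) * exp (\<i> * of_real (l n * Re z)))"
    using assms(1) unfolding finite_exp_sum_def by blast
  obtain N :: nat and d k where Q: "\<forall>n<N. continuous_on {\<alpha>..\<beta>} (d n)"
      "\<forall>z\<in>strip \<alpha> \<beta>. Q z = (\<Sum>n<N. d n (Im z) * exp (\<i> * of_real (k n * Re z)))"
    using assms(2) unfolding finite_exp_sum_def by blast
  show ?thesis
    unfolding finite_exp_sum_def
  proof (intro exI conjI)
    show "\<forall>n<M + N. continuous_on {\<alpha>..\<beta>} ((\<lambda>n. if n < M then c n else d (n - M)) n)"
      using P(1) Q(1) by auto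
    show "\<forall>z\<in>strip \<alpha> \<beta>. P z + Q z = (\<Sum>n<M + N. (\<lambda>n. if n < M then c n else d (n - M)) n (Im z) *
        exp (\<i> * of_real ((\<lambda>n. if n < M then l n else k (n - M)) n * Re z)))"
      using P(2) Q(2) by (simp add: sum_lessThan_add)
  qed
qed

text \<open>Since exp(iaz) = exp(-ay) exp(iax), the factor exp(-ay) joins the continuous
  coefficients and \<open>a\<close> shifts the frequencies.\<close>

lemma finite_exp_sum_mult_exp:
  assumes "finite_exp_sum \<alpha> \<beta> Q"
  shows "finite_exp_sum \<alpha> \<beta> (\<lambda>z. k * exp (\<i> * of_real a * z) * Q z)"
proof -
  obtain N :: nat and c l where Q: "\<forall>n<N. continuous_on {\<alpha>..\<beta>} (c n)"
      "\<forall>z\<in>strip \<alpha> \<beta>. Q z = (\<Sum>n<N. c n (Im z) * exp (\<i> * of_real (l n * Re z)))"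
    using assms unfolding finite_exp_sum_def by blast
  show ?thesis
    unfolding finite_exp_sum_def
  proof (intro exI conjI)
    show "\<forall>n<N. continuous_on {\<alpha>..\<beta>} ((\<lambda>n y. k * exp (of_real (- (a * y))) * c n y) n)"
      using Q(1) by (auto intro!: continuous_intros)
    show "\<forall>z\<in>strip \<alpha> \<beta>. k * exp (\<i> * of_real a * z) * Q z =
        (\<Sum>n<N. (\<lambda>n y. k * exp (of_real (- (a * y))) * c n y) n (Im z) * exp (\<i> * of_real ((\<lambda>n. a + l n) n * Re z)))"
    proof
      fix z assume z: "z \<in> strip \<alpha> \<beta>"
      have e: "exp (\<i> * of_real a * z) * exp (\<i> * of_real (l n * Re z)) =
          exp (of_real (- (a * Im z))) * exp (\<i> * of_real ((a + l n) * Re z))" for n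
        unfolding exp_add[symmetric] by (rule arg_cong[of _ _ exp]) (simp add: complex_eq_iff algebra_simps)
      have "k * exp (\<i> * of_real a * z) * Q z =
          (\<Sum>n<N. k * c n (Im z) * (exp (\<i> * of_real a * z) * exp (\<i> * of_real (l n * Re z))))"
        using Q(2) z by (simp add: sum_distrib_left mult_ac)
      then show "k * exp (\<i> * of_real a * z) * Q z =
        (\<Sum>n<N. (\<lambda>n y. k * exp (of_real (- (a * y))) * c n y) n (Im z) * exp (\<i> * of_real ((\<lambda>n. a + l n) n * Re z)))"
        unfolding e by (simp add: mult_ac)
    qed
  qed
qed

text \<open>Euler's formula and induction on the exponent. The prefactor \<open>k\<close> is
  included so that a spike with its amplitude is an instance.\<close>

lemma finite_exp_sum_sin_power:
  "finite_exp_sum \<alpha> \<beta> (\<lambda>z. k * sin (of_real a * z) ^ n)"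
proof (induction n)
  case 0
  show ?case by (simp add: finite_exp_sum_const)
next
  case (Suc n)
  have "(\<lambda>z. k * sin (of_real a * z) ^ Suc n) =
    (\<lambda>z. (- \<i> / 2) * exp (\<i> * of_real a * z) * (k * sin (of_real a * z) ^ n)
      + \<i> / 2 * exp (\<i> * of_real (- a) * z) * (k * sin (of_real a * z) ^ n))"
  proof
    fix z
    have "sin (of_real a * z) = (- \<i> / 2) * exp (\<i> * of_real a * z) + \<i> / 2 * exp (\<i> * of_real (- a) * z)"
      by (simp add: sin_exp_eq mult.assoc field_simps)
    moreover have "k * sin (of_real a * z) ^ Suc n = sin (of_real a * z) * (k * sin (of_real a * z) ^ n)"
      by simp
    ultimately show "k * sin (of_real a * z) ^ Suc n =
      (- \<i> / 2) * exp (\<i> * of_real a * z) * (k * sin (of_real a * z) ^ n)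
      + \<i> / 2 * exp (\<i> * of_real (- a) * z) * (k * sin (of_real a * z) ^ n)"
      by (simp only: distrib_right[symmetric])
  qed
  then show ?case
    by (simp only:) (intro finite_exp_sum_add finite_exp_sum_mult_exp Suc.IH)
qed

lemma finite_exp_sum_spike_sum: "finite_exp_sum \<alpha> \<beta> (\<lambda>z. \<Sum>k<K. spike r m k z)"
proof (induction K)
  case 0
  show ?case by (simp add: finite_exp_sum_const)
next
  case (Suc K)
  have "finite_exp_sum \<alpha> \<beta> (spike r m K)"
    unfolding spike_def bump_def by (rule finite_exp_sum_sin_power)
  then show ?case using finite_exp_sum_add[OF Suc] by simp
qed

section \<open>Bounds on the distance, and membership of the series in the space\<close>

lemma besicovitch_dist_leI:
  assumes "0 < p" "0 \<le> D"
    and "\<And>T y. 0 < T \<Longrightarrow> y \<in> {\<alpha>..\<beta>} \<Longrightarrow>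
      (\<integral>\<^sup>+x. ennreal (norm (f (Complex x y) - g (Complex x y)) powr p) * indicator {-T..T} x \<partial>lborel)
        \<le> ennreal (2 * T * D)"
  shows "besicovitch_dist p \<alpha> \<beta> f g \<le> ereal (D powr (1 / p))"
  unfolding besicovitch_dist_def
proof (rule Limsup_bounded)
  show "\<forall>\<^sub>F T in at_top. (SUP y\<in>{\<alpha>..\<beta>}. ereal ((1 / (2 * T) *
      (LINT t:{-T..T}|lebesgue. norm (f (Complex t y) - g (Complex t y)) powr p)) powr (1 / p)))
    \<le> ereal (D powr (1 / p))"
    using eventually_gt_at_top[of 0]
  proof eventually_elim
    case (elim T)
    show ?case
    proof (rule SUP_least)
      fix y assume y: "y \<in> {\<alpha>..\<beta>}"
      define I where "I = (LINT t:{-T..T}|lebesgue. norm (f (Complex t y) - g (Complex t y)) powr p)"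
      have "0 \<le> I" unfolding I_def set_lebesgue_integral_def
        by (intro Bochner_Integration.integral_nonneg) auto
      have "I \<le> 2 * T * D"
        unfolding I_def set_lebesgue_integral_def
      \<comment> \<open>A bound on the nonnegative integral bounds the Bochner integral without any
        proof of integrability; the default value 0 does no harm in an upper bound.\<close>
      proof (rule integral_real_bounded)
        have "(\<integral>\<^sup>+x. ennreal (indicator {-T..T} x *\<^sub>R norm (f (Complex x y) - g (Complex x y)) powr p) \<partial>lebesgue)
          = (\<integral>\<^sup>+x. ennreal (norm (f (Complex x y) - g (Complex x y)) powr p) * indicator {-T..T} x \<partial>lborel)"
          unfolding nn_integral_completion
          by (intro nn_integral_cong) (auto simp: indicator_def)
        then show "(\<integral>\<^sup>+x. ennreal (indicator {-T..T} x *\<^sub>R norm (f (Complex x y) - g (Complex x y)) powr p) \<partial>lebesgue)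
          \<le> ennreal (2 * T * D)"
          using assms(3)[OF elim y] by simp
      qed (use elim assms(2) in simp)
      then have "1 / (2 * T) * I \<le> D" using elim by (simp add: field_simps)
      then show "ereal ((1 / (2 * T) * (LINT t:{-T..T}|lebesgue. norm (f (Complex t y) - g (Complex t y)) powr p)) powr (1 / p))
          \<le> ereal (D powr (1 / p))"
        unfolding I_def[symmetric] using elim assms(1) \<open>0 \<le> I\<close> by (simp add: powr_mono2)
    qed
  qed
qed

lemma continuous_imp_besicovitch_admissible:
  assumes f: "continuous_on UNIV f" and "0 < p"
  shows "besicovitch_admissible p \<alpha> \<beta> f"
  unfolding besicovitch_admissible_def
proof (intro conjI ballI allI impI)
  have "closed (strip \<alpha> \<beta>)"
    unfolding strip_def by (intro closed_Collect_conj closed_Collect_le continuous_intros)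
  then show "f \<in> borel_measurable (lebesgue_on (strip \<alpha> \<beta>))"
    using f by (intro continuous_imp_measurable_on_sets_lebesgue)
      (auto intro: continuous_on_subset)
next
  fix y T :: real
  have sec: "continuous_on UNIV (\<lambda>x. f (Complex x y))"
    unfolding Complex_eq by (intro continuous_on_compose2[OF f] continuous_intros) auto
  then show "(\<lambda>x. f (Complex x y)) \<in> borel_measurable lebesgue"
    by (intro measurable_completion) (simp add: borel_measurable_continuous_onI)
  have "continuous_on {-T..T} (\<lambda>x. norm (f (Complex x y)) powr p)"
    using assms(2) by (intro continuous_on_powr' continuous_intros continuous_on_subset[OF sec]) auto
  then have "set_integrable lborel {-T..T} (\<lambda>x. norm (f (Complex x y)) powr p)"
    unfolding set_integrable_def by (intro borel_integrable_compact) auto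
  then show "set_integrable lebesgue {-T..T} (\<lambda>x. norm (f (Complex x y)) powr p)"
    unfolding set_integrable_def by (subst integrable_completion) auto
qed

lemma spike_series_in_besicovitch_space:
  assumes "1 \<le> p" "p + 1 \<le> real m * (1 - r * p)" "1 \<le> m" "r \<le> 1"
  shows "spike_series r m \<in> besicovitch_space p \<alpha> \<beta>"
  unfolding besicovitch_space_def
proof (intro CollectI conjI allI impI)
  show "besicovitch_admissible p \<alpha> \<beta> (spike_series r m)"
    using assms(1) by (intro continuous_imp_besicovitch_admissible holomorphic_on_imp_continuous_on
        holomorphic_spike_series assms) auto
  fix \<epsilon> :: real assume \<epsilon>: "0 < \<epsilon>"
  \<comment> \<open>The symmetric strip of half-width \<open>H\<close> contains the given one, which
    makes the tail bound uniform in the height.\<close>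
  define H where "H = max \<bar>\<alpha>\<bar> \<bar>\<beta>\<bar>"
  define C where "C = 28 * bump_const H powr p"
  have "(\<lambda>K. C * (1/2) ^ K) \<longlonglongrightarrow> C * 0"
    by (intro tendsto_mult_left LIMSEQ_power_zero) simp
  then have "\<forall>\<^sub>F K in sequentially. C * (1/2) ^ K < \<epsilon> powr p"
    using \<epsilon> by (intro order_tendstoD) auto
  then obtain K where K: "C * (1/2) ^ K < \<epsilon> powr p"
    by (auto simp: eventually_sequentially)
  have C: "0 \<le> C" by (simp add: C_def)
  have "besicovitch_dist p \<alpha> \<beta> (spike_series r m) (\<lambda>z. \<Sum>k<K. spike r m k z)
      \<le> ereal ((C * (1/2) ^ K) powr (1 / p))"
  proof (rule besicovitch_dist_leI)
    fix T y :: real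
    assume T: "0 < T" and "y \<in> {\<alpha>..\<beta>}"
    then have "\<bar>y\<bar> \<le> H" by (auto simp: H_def)
    then show "(\<integral>\<^sup>+x. ennreal (norm (spike_series r m (Complex x y) - (\<Sum>k<K. spike r m k (Complex x y))) powr p)
        * indicator {-T..T} x \<partial>lborel) \<le> ennreal (2 * T * (C * (1/2) ^ K))"
      unfolding C_def by (intro nn_integral_spike_series_tail_le T assms)
  qed (use assms(1) C in auto)
  also have "(C * (1/2) ^ K) powr (1 / p) < (\<epsilon> powr p) powr (1 / p)"
    using K C assms(1) by (intro powr_less_mono2) auto
  also have "(\<epsilon> powr p) powr (1 / p) = \<epsilon>"
    using \<epsilon> assms(1) by (simp add: powr_powr)
  finally have "besicovitch_dist p \<alpha> \<beta> (spike_series r m) (\<lambda>z. \<Sum>k<K. spike r m k z) < ereal \<epsilon>"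
    by simp
  then show "\<exists>Q. finite_exp_sum \<alpha> \<beta> Q \<and> besicovitch_dist p \<alpha> \<beta> (spike_series r m) Q < ereal \<epsilon>"
    using finite_exp_sum_spike_sum by blast
qed

text \<open>The supremum over heights dominates the value at any single height, so a small distance
  controls the means along one horizontal line. It is applied to the real axis.\<close>

lemma besicovitch_dist_lessD:
  assumes "besicovitch_dist p \<alpha> \<beta> f g < ereal \<epsilon>" "y \<in> {\<alpha>..\<beta>}" "0 < p"
  shows "\<forall>\<^sub>F T in at_top. (LINT t:{-T..T}|lebesgue. norm (f (Complex t y) - g (Complex t y)) powr p)
    \<le> 2 * T * \<epsilon> powr p"
proof -
  have "\<forall>\<^sub>F T in at_top. (SUP y\<in>{\<alpha>..\<beta>}. ereal ((1 / (2 * T) *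
      (LINT t:{-T..T}|lebesgue. norm (f (Complex t y) - g (Complex t y)) powr p)) powr (1 / p))) < ereal \<epsilon>"
    using assms(1) unfolding besicovitch_dist_def by (rule Limsup_lessD)
  then show ?thesis
    using eventually_gt_at_top[of 0]
  proof eventually_elim
    case (elim T)
    define I where "I = (LINT t:{-T..T}|lebesgue. norm (f (Complex t y) - g (Complex t y)) powr p)"
    have "0 \<le> I" unfolding I_def set_lebesgue_integral_def
      by (intro Bochner_Integration.integral_nonneg) auto
    then have "((1 / (2 * T) * I) powr (1 / p)) powr p = 1 / (2 * T) * I"
      using assms(3) elim(2) by (simp add: powr_powr)
    moreover
    have "ereal ((1 / (2 * T) * I) powr (1 / p)) < ereal \<epsilon>"
      unfolding I_def by (rule le_less_trans[OF SUP_upper[OF assms(2)] elim(1)])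
    then have "((1 / (2 * T) * I) powr (1 / p)) powr p \<le> \<epsilon> powr p"
      using assms(3) by (intro powr_mono2) auto
    ultimately have "1 / (2 * T) * I \<le> \<epsilon> powr p" by simp
    then show ?case unfolding I_def[symmetric] using elim(2) by (simp add: field_simps)
  qed
qed

text \<open>From |u - v| <= 2 max(|u|, |v|). Integrability matters here because a Bochner integral
  could otherwise be 0 by default, and a small distance would say nothing about the size of the
  difference.\<close>

lemma set_integrable_norm_diff_powr:
  fixes u v :: "real \<Rightarrow> complex"
  assumes [measurable]: "u \<in> borel_measurable lebesgue" "v \<in> borel_measurable lebesgue"
    and "set_integrable lebesgue {a..b} (\<lambda>x. norm (u x) powr p)"
    and "set_integrable lebesgue {a..b} (\<lambda>x. norm (v x) powr p)"
    and p: "0 \<le> p"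
  shows "set_integrable lebesgue {a..b} (\<lambda>x. norm (u x - v x) powr p)"
proof -
  have "set_integrable lebesgue {a..b} (\<lambda>x. 2 powr p * (norm (u x) powr p + norm (v x) powr p))"
    using assms(3,4) by auto
  then have "integrable lebesgue (\<lambda>x. indicator {a..b} x *\<^sub>R (2 powr p * (norm (u x) powr p + norm (v x) powr p)))"
    by (simp add: set_integrable_def)
  then show ?thesis
    unfolding set_integrable_def
  proof (rule Bochner_Integration.integrable_bound)
    show "AE x in lebesgue. norm (indicator {a..b} x *\<^sub>R norm (u x - v x) powr p)
        \<le> norm (indicator {a..b} x *\<^sub>R (2 powr p * (norm (u x) powr p + norm (v x) powr p)))"
    proof (rule AE_I2)
      fix x
      have "norm (u x - v x) \<le> 2 * max (norm (u x)) (norm (v x))"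
        using norm_triangle_ineq4[of "u x" "v x"] by linarith
      then have "norm (u x - v x) powr p \<le> (2 * max (norm (u x)) (norm (v x))) powr p"
        using p by (intro powr_mono2) auto
      also have "\<dots> = 2 powr p * max (norm (u x)) (norm (v x)) powr p"
        by (simp add: powr_mult)
      also have "\<dots> \<le> 2 powr p * (norm (u x) powr p + norm (v x) powr p)"
        by (intro mult_left_mono) (auto simp: max_def)
      finally show "norm (indicator {a..b} x *\<^sub>R norm (u x - v x) powr p)
        \<le> norm (indicator {a..b} x *\<^sub>R (2 powr p * (norm (u x) powr p + norm (v x) powr p)))"
        by (simp add: indicator_def)
    qed
    show "(\<lambda>x. indicator {a..b} x *\<^sub>R norm (u x - v x) powr p) \<in> borel_measurable lebesgue"
      by (intro borel_measurable_scaleR borel_measurable_indicator powr_real_measurable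
          borel_measurable_norm borel_measurable_diff assms measurable_const) auto
  qed
qed

text \<open>At a fixed height the coefficients are constants and the exponentials have modulus 1, so
  the sum of the moduli of the coefficients is a bound.\<close>

lemma finite_exp_sum_section:
  assumes "finite_exp_sum \<alpha> \<beta> Q" "y \<in> {\<alpha>..\<beta>}"
  obtains B where "continuous_on UNIV (\<lambda>x. Q (Complex x y))" "\<And>x. norm (Q (Complex x y)) \<le> B"
proof -
  obtain N :: nat and c l where Q: "\<forall>z\<in>strip \<alpha> \<beta>. Q z = (\<Sum>n<N. c n (Im z) * exp (\<i> * of_real (l n * Re z)))"
    using assms(1) unfolding finite_exp_sum_def by blast
  have eq: "Q (Complex x y) = (\<Sum>n<N. c n y * exp (\<i> * of_real (l n * x)))" for x
    using Q assms(2) by (simp add: strip_def)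
  show thesis
  proof
    show "continuous_on UNIV (\<lambda>x. Q (Complex x y))"
      unfolding eq by (intro continuous_intros)
    show "norm (Q (Complex x y)) \<le> (\<Sum>n<N. norm (c n y))" for x
      unfolding eq by (rule sum_norm_le) (simp add: norm_mult flip: cis_conv_exp)
  qed
qed

subsection \<open>Lower bound on the real axis\<close>

text \<open>No cancellation occurs on the real axis, where all spikes are nonnegative, so the single
  spike that peaks near x bounds the series from below.\<close>

lemma Re_spike_series_ge:
  fixes i :: int
  assumes "1 \<le> m" "r \<le> 1" and "\<bar>x - (of_int i + 1/2) * 2 ^ (m * Suc k)\<bar> \<le> 1/6"
  shows "(2 ^ (m * Suc k)) powr r / 2 \<le> Re (spike_series r m (of_real x))"
proof -
  have Re: "Re (spike r m j (of_real x)) = (2 ^ (m * Suc j)) powr r * Re (bump (m * Suc j) (of_real x))" for j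
    by (simp add: spike_def)
  have summ: "summable (\<lambda>j. spike r m j (of_real x))"
    by (rule summable_norm_cancel[OF summable_norm_spike[OF assms(1,2)]])
  have "(2 ^ (m * Suc k)) powr r / 2 \<le> Re (spike r m k (of_real x))"
    using mult_left_mono[OF bump_near_peak_ge[OF assms(3)], of "(2 ^ (m * Suc k)) powr r"] by (simp add: Re)
  also have "\<dots> = (\<Sum>j\<in>{k}. Re (spike r m j (of_real x)))" by simp
  also have "\<dots> \<le> (\<Sum>j. Re (spike r m j (of_real x)))"
    using Re_bump_of_real_nonneg by (intro sum_le_suminf summable_Re summ) (auto simp: Re)
  also have "\<dots> = Re (spike_series r m (of_real x))"
    unfolding spike_series_def by (rule Re_suminf[OF summ, symmetric])
  finally show ?thesis .
qed

text \<open>The M peaks between 0 and M L carry intervals of length 1/3 on which F is at least 1.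
  Leaving out the negative half-axis costs only a factor 2.\<close>

lemma set_integral_ge_peaks:
  fixes F :: "real \<Rightarrow> real" and L :: real and M :: nat
  assumes L: "1 \<le> L" and F: "set_integrable lebesgue {-(M * L)..M * L} F" "\<And>x. 0 \<le> F x"
    and ge: "\<And>x i::nat. \<bar>x - (i + 1/2) * L\<bar> \<le> 1/6 \<Longrightarrow> 1 \<le> F x"
  shows "M / 3 \<le> (LINT x:{-(M * L)..M * L}|lebesgue. F x)"
proof -
  define J where "J i = {(real i + 1/2) * L - 1/6..(real i + 1/2) * L + 1/6}" for i
  have "M / 3 = (\<Sum>i<M. (LINT x|lebesgue. indicator (J i) x))"
    by (simp add: J_def)
  also have "\<dots> = (LINT x|lebesgue. (\<Sum>i<M. indicator (J i) x))"
    by (rule Bochner_Integration.integral_sum[symmetric]) (simp add: J_def)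
  also have "\<dots> \<le> (LINT x:{-(M * L)..M * L}|lebesgue. F x)"
    unfolding set_lebesgue_integral_def
  proof (rule integral_mono)
    show "integrable lebesgue (\<lambda>x. \<Sum>i<M. indicator (J i) x :: real)"
      by (intro Bochner_Integration.integrable_sum) (simp add: J_def)
    show "integrable lebesgue (\<lambda>x. indicator {-(M * L)..M * L} x *\<^sub>R F x)"
      using F(1) by (simp add: set_integrable_def)
    fix x
    show "(\<Sum>i<M. indicator (J i) x) \<le> indicator {-(M * L)..M * L} x *\<^sub>R F x"
    proof (cases "\<exists>i<M. x \<in> J i")
      case False
      then have "(\<Sum>i<M. indicator (J i) x) = (0::real)" by (intro sum.neutral) auto
      then show ?thesis using F(2)[of x] by simp
    next
      case True
      then obtain i where i: "i < M" "x \<in> J i" by blast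
      \<comment> \<open>Distinct centres are at least L >= 1 apart, whereas a common point would
        force a distance of at most 1/3.\<close>
      have other: "x \<notin> J k" if "k \<noteq> i" for k
      proof
        assume "x \<in> J k"
        then have "\<bar>x - (real k * L + L / 2)\<bar> \<le> 1/6" "\<bar>x - (real i * L + L / 2)\<bar> \<le> 1/6"
          using i(2) unfolding J_def atLeastAtMost_iff distrib_right by linarith+
        then have "\<bar>(real k - real i) * L\<bar> \<le> 1/3"
          unfolding left_diff_distrib by linarith
        moreover have "1 \<le> \<bar>real k - real i\<bar>" using that by linarith
        then have "1 * 1 \<le> \<bar>real k - real i\<bar> * L" using L by (intro mult_mono) auto
        ultimately show False using L by (simp add: abs_mult)
      qed
      have "(\<Sum>k<M. indicator (J k) x) = (\<Sum>k\<in>{i}. indicator (J k) x :: real)"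
        using i other by (intro sum.mono_neutral_right) auto
      then have s: "(\<Sum>k<M. indicator (J k) x) = (1::real)" using i(2) by simp
      have "(real i + 1) * L \<le> M * L" using i(1) L by (intro mult_right_mono) auto
      moreover have "0 \<le> real i * L" using L by simp
      ultimately have "x \<in> {-(M * L)..M * L}"
        using i(2) L unfolding J_def atLeastAtMost_iff distrib_right by linarith
      moreover have "1 \<le> F x" using i(2) unfolding J_def atLeastAtMost_iff by (intro ge[of x i]) linarith
      ultimately show ?thesis using s by simp
    qed
  qed
  finally show ?thesis .
qed

text \<open>The second quantity equals 8^p' L^(1 - rp'), which tends to 0 because rp' > 1. The
  constants 4, 8 and 1/12 are those of the counting argument that follows.\<close>

lemma exists_spike_height:
  fixes B p' r :: real
  assumes "1 \<le> m" "0 < r" "1 < r * p'"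
  obtains k where "4 * B \<le> (2 ^ (m * Suc k)) powr r"
    and "2 ^ (m * Suc k) * (8 / (2 ^ (m * Suc k)) powr r) powr p' < 1 / 12"
proof -
  have top: "filterlim (\<lambda>k. 2 ^ (m * Suc k) :: real) at_top sequentially"
  proof (rule filterlim_at_top_mono)
    show "filterlim (\<lambda>k. 2 ^ k :: real) at_top sequentially"
      by real_asymp
    have "k \<le> m * Suc k" for k using mult_le_mono1[OF assms(1), of "Suc k"] by simp
    then show "\<forall>\<^sub>F k in sequentially. (2::real) ^ k \<le> 2 ^ (m * Suc k)"
      by (intro always_eventually allI power_increasing) auto
  qed
  have "filterlim (\<lambda>L::real. L powr r) at_top at_top"
    using assms(2) by real_asymp
  then have "\<forall>\<^sub>F L::real in at_top. 4 * B \<le> L powr r"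
    by (simp add: filterlim_at_top)
  moreover have "((\<lambda>L::real. 8 powr p' * L powr (1 - r * p')) \<longlongrightarrow> 8 powr p' * 0) at_top"
    using assms(3) by (intro tendsto_mult_left tendsto_neg_powr filterlim_ident) auto
  then have "\<forall>\<^sub>F L::real in at_top. 8 powr p' * L powr (1 - r * p') < 1 / 12"
    by (intro order_tendstoD) auto
  ultimately have "\<forall>\<^sub>F L::real in at_top. 4 * B \<le> L powr r \<and> L * (8 / L powr r) powr p' < 1 / 12"
    using eventually_gt_at_top[of 0]
  proof eventually_elim
    case (elim L)
    have "L * (8 / L powr r) powr p' = 8 powr p' * L powr (1 - r * p')"
      using elim(3) by (simp add: powr_divide powr_powr powr_diff)
    then show ?case using elim by simp
  qed
  from eventually_compose_filterlim[OF this top] show thesis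
    using that by (auto simp: eventually_sequentially)
qed

section \<open>Contradiction for equivalent functions, and conclusion\<close>

lemma spike_series_not_equiv:
  assumes p: "1 \<le> p" "p < p'" and r: "r \<le> 1" "1 < r * p'" and m: "1 \<le> m" and H: "0 < H"
    and equiv: "besicovitch_equiv p (-H) H (spike_series r m) g"
  shows "g \<notin> besicovitch_space p' (-H) H"
proof
  assume g: "g \<in> besicovitch_space p' (-H) H"
  have y: "0 \<in> {-H..H}" using H by simp
  have p': "0 < p'" using p by linarith
  have r0: "0 < r" using r(2) p' by (metis less_trans zero_less_mult_pos2 zero_less_one)
  define u where "u x = spike_series r m (Complex x 0)" for x
  define v where "v x = g (Complex x 0)" for x
  obtain Q where Q: "finite_exp_sum (-H) H Q" "besicovitch_dist p' (-H) H g Q < ereal 1"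
  proof -
    have "(0::real) < 1 \<longrightarrow> (\<exists>Q. finite_exp_sum (-H) H Q \<and> besicovitch_dist p' (-H) H g Q < ereal 1)"
      using g unfolding besicovitch_space_def by blast
    then show thesis using that by auto
  qed
  define w where "w x = Q (Complex x 0)" for x
  obtain B where w: "continuous_on UNIV w" "\<And>x. norm (w x) \<le> B"
    using finite_exp_sum_section[OF Q(1) y] unfolding w_def by metis
  have meas: "u \<in> borel_measurable lebesgue" "v \<in> borel_measurable lebesgue"
    and int: "\<And>T. 0 < T \<Longrightarrow> set_integrable lebesgue {-T..T} (\<lambda>x. norm (u x) powr p)"
      "\<And>T. 0 < T \<Longrightarrow> set_integrable lebesgue {-T..T} (\<lambda>x. norm (v x) powr p)"
      "\<And>T. 0 < T \<Longrightarrow> set_integrable lebesgue {-T..T} (\<lambda>x. norm (v x) powr p')"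
    using equiv g y unfolding u_def v_def besicovitch_equiv_def besicovitch_space_def besicovitch_admissible_def
    by auto
  have w_adm: "w \<in> borel_measurable lebesgue"
    "\<And>T. 0 < T \<Longrightarrow> set_integrable lebesgue {-T..T} (\<lambda>x. norm (w x) powr p')"
  proof -
    \<comment> \<open>Extending \<open>w\<close> constantly in the imaginary direction makes the
      admissibility lemma for continuous functions on the plane applicable.\<close>
    have "continuous_on UNIV (\<lambda>z. w (Re z))"
      by (intro continuous_on_compose2[OF w(1)] continuous_intros) auto
    from continuous_imp_besicovitch_admissible[OF this p', of 0 0]
    show "w \<in> borel_measurable lebesgue"
      "\<And>T. 0 < T \<Longrightarrow> set_integrable lebesgue {-T..T} (\<lambda>x. norm (w x) powr p')"
      by (simp_all add: besicovitch_admissible_def)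
  qed
  obtain k where k: "4 * B \<le> (2 ^ (m * Suc k)) powr r"
      "2 ^ (m * Suc k) * (8 / (2 ^ (m * Suc k)) powr r) powr p' < 1 / 12"
    using exists_spike_height[OF m r0 r(2)] by metis
  define L :: real where "L = 2 ^ (m * Suc k)"
  \<comment> \<open>The peak height L^r/2 is 4b. The exponential sum accounts for at most B <= 2b of
    it, so at a peak one of |u - v| and |v - w| must be at least b.\<close>
  define b where "b = L powr r / 8"
  have L: "1 \<le> L" by (simp add: L_def del: mult_Suc_right)
  have b: "0 < b" "B \<le> 2 * b" using L k(1)[folded L_def] by (auto simp: b_def)
  have b': "L * (1 / b) powr p' < 1 / 12" using k(2)[folded L_def] by (simp add: b_def)
  \<comment> \<open>The scale L is fixed by now, and the distance 0 allows any positive tolerance.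
    This one makes L (1/b)^p eta^p equal to 1/12.\<close>
  define \<eta> where "\<eta> = (1 / (12 * L * (1 / b) powr p)) powr (1 / p)"
  have \<eta>: "0 < \<eta>" using L b(1) by (simp add: \<eta>_def)
  have \<eta>p: "\<eta> powr p = 1 / (12 * L * (1 / b) powr p)"
    using p L b(1) by (simp add: \<eta>_def powr_powr)
  have "besicovitch_dist p (-H) H (spike_series r m) g < ereal \<eta>"
    using equiv \<eta> by (simp add: besicovitch_equiv_def)
  from besicovitch_dist_lessD[OF this y]
  have "\<forall>\<^sub>F T in at_top. (LINT t:{-T..T}|lebesgue. norm (u t - v t) powr p) \<le> 2 * T * \<eta> powr p"
    using p by (simp add: u_def v_def)
  moreover from besicovitch_dist_lessD[OF Q(2) y p']
  have "\<forall>\<^sub>F T in at_top. (LINT t:{-T..T}|lebesgue. norm (v t - w t) powr p') \<le> 2 * T * 1"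
    by (simp add: v_def w_def)
  ultimately have "\<forall>\<^sub>F T in at_top. (LINT t:{-T..T}|lebesgue. norm (u t - v t) powr p) \<le> 2 * T * \<eta> powr p
      \<and> (LINT t:{-T..T}|lebesgue. norm (v t - w t) powr p') \<le> 2 * T * 1"
    by (rule eventually_conj)
  then obtain T0 where T0: "\<And>T. T0 \<le> T \<Longrightarrow> (LINT t:{-T..T}|lebesgue. norm (u t - v t) powr p) \<le> 2 * T * \<eta> powr p
      \<and> (LINT t:{-T..T}|lebesgue. norm (v t - w t) powr p') \<le> 2 * T * 1"
    by (auto simp: eventually_at_top_linorder)
  \<comment> \<open>The window half-length is a multiple of L, to fit the count of peaks. Being at
    least \<open>T0\<close>, M makes both mean bounds available; being at least 1, it makes the
    final inequality strict.\<close>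
  obtain M :: nat where M: "max T0 1 \<le> M" using real_arch_simple by blast
  define T where "T = M * L"
  have "max T0 1 * 1 \<le> M * L" using M L by (intro mult_mono) auto
  then have T: "T0 \<le> T" "1 \<le> T" by (auto simp: T_def)
  have i1: "set_integrable lebesgue {-T..T} (\<lambda>x. norm (u x - v x) powr p)"
    using p T by (intro set_integrable_norm_diff_powr meas int) auto
  have i2: "set_integrable lebesgue {-T..T} (\<lambda>x. norm (v x - w x) powr p')"
    using p' T by (intro set_integrable_norm_diff_powr meas int w_adm) auto
  \<comment> \<open>A Chebyshev argument for both differences at once: after scaling by 1/b,
    whichever difference is at least b makes its summand at least 1.\<close>
  define F where "F x = (1 / b) powr p * norm (u x - v x) powr p + (1 / b) powr p' * norm (v x - w x) powr p'" for x
  have "M / 3 \<le> (LINT x:{-(M * L)..M * L}|lebesgue. F x)"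
  proof (rule set_integral_ge_peaks[OF L])
    show "set_integrable lebesgue {-(M * L)..M * L} F"
      unfolding F_def T_def[symmetric] using i1 i2 by auto
    show "0 \<le> F x" for x by (simp add: F_def)
    fix x :: real and i :: nat
    assume "\<bar>x - (i + 1/2) * L\<bar> \<le> 1/6"
    then have "L powr r / 2 \<le> Re (u x)"
      using Re_spike_series_ge[OF m r(1), of x "int i" k] by (simp add: L_def u_def complex_of_real_def)
    also have "\<dots> \<le> norm (u x)" by (rule complex_Re_le_cmod)
    also have "u x = (u x - v x) + (v x - w x) + w x" by simp
    also have "norm \<dots> \<le> norm (u x - v x) + norm (v x - w x) + norm (w x)"
      by (meson norm_triangle_ineq norm_triangle_mono order_refl)
    finally have "2 * b \<le> norm (u x - v x) + norm (v x - w x)"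
      using w(2)[of x] b(2) by (simp add: b_def)
    then consider "b \<le> norm (u x - v x)" | "b \<le> norm (v x - w x)" by linarith
    then show "1 \<le> F x"
    proof cases
      case 1
      then have "1 powr p \<le> (1 / b * norm (u x - v x)) powr p"
        using b(1) p by (intro powr_mono2) (auto simp: field_simps)
      then have "1 \<le> (1 / b) powr p * norm (u x - v x) powr p"
        using b(1) by (simp only: powr_mult powr_one_eq_one)
      then show ?thesis by (simp add: F_def add_increasing2)
    next
      case 2
      then have "1 powr p' \<le> (1 / b * norm (v x - w x)) powr p'"
        using b(1) p' by (intro powr_mono2) (auto simp: field_simps)
      then have "1 \<le> (1 / b) powr p' * norm (v x - w x) powr p'"
        using b(1) by (simp only: powr_mult powr_one_eq_one)
      then show ?thesis by (simp add: F_def add_increasing)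
    qed
  qed
  also have "\<dots> = (1 / b) powr p * (LINT x:{-T..T}|lebesgue. norm (u x - v x) powr p)
      + (1 / b) powr p' * (LINT x:{-T..T}|lebesgue. norm (v x - w x) powr p')"
    unfolding F_def T_def[symmetric] using i1 i2
    by (subst set_integral_add) auto
  also have "\<dots> \<le> (1 / b) powr p * (2 * T * \<eta> powr p) + (1 / b) powr p' * (2 * T * 1)"
    using T0[OF T(1)] by (intro add_mono mult_left_mono) auto
  also have "\<dots> = 2 * M * (1 / 12 + L * (1 / b) powr p')"
    using L b(1) by (simp add: \<eta>p T_def field_simps)
  \<comment> \<open>The right side equals M/3, the lower bound from the count of peaks.\<close>
  also have "\<dots> < 2 * M * (1 / 12 + 1 / 12)"
    using b' M by (intro mult_strict_left_mono add_strict_left_mono) auto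
  finally show False by simp
qed

theorem theorem4:
  fixes p p' :: real
  assumes "p \<ge> 1" and "p' > p"
  shows "\<exists>f\<in>entire_besicovitch p. \<forall>H>0. \<forall>g.
           besicovitch_equiv p (-H) H f g \<longrightarrow> g \<notin> besicovitch_space p' (-H) H"
proof -
  \<comment> \<open>The reciprocal of \<open>r\<close> is the midpoint of p and p', hence rp < 1 <
    rp'; and r <= 1 because p + p' > 2.\<close>
  define r where "r = 2 / (p + p')"
  have r: "r \<le> 1" "1 < r * p'" "r * p < 1"
    using assms by (auto simp: r_def field_simps)
  obtain n :: nat where n: "(p + 1) / (1 - r * p) \<le> real n" using real_arch_simple by blast
  define m where "m = max 1 n"
  have m: "1 \<le> m" by (simp add: m_def)
  have "(p + 1) / (1 - r * p) \<le> real m" using n by (simp add: m_def)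
  then have "p + 1 \<le> real m * (1 - r * p)" using r(3) by (simp add: field_simps)
  then have "spike_series r m \<in> entire_besicovitch p"
    unfolding entire_besicovitch_def
    using holomorphic_spike_series[OF m r(1)] spike_series_in_besicovitch_space[OF assms(1) _ m r(1)] by blast
  then show ?thesis
    using spike_series_not_equiv[OF assms r(1,2) m] by blast
qed

end
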